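(* Let $\le$ be a stability on $S$, let $s$ be the corresponding Harder–Narasimhan collection and let $s^{-1}$ be its inverse with respect to plethysm. For any $\alpha\in S^n$ and $1\le k<n$, let $\alpha_{\le k}=\alpha_1+\dots+\alpha_k$ and $\alpha_{>k}=\alpha_{k+1}+\dots+\alpha_n$. Then $$s^{-1}(\alpha)=\begin{cases}(-1)^{n-1}&\text{if }\alpha_{\le k}>\alpha_{>k}\text{ for all }1\le k<n,\\0&\text{otherwise.}\end{cases}$$
   Context: $S$ is a commutative semigroup (written additively) such that every element of $S$ can be represented as a sum $\alpha_1+\dots+\alpha_n$ ($n\ge1$, $\alpha_i\in S$) in only finitely many ways (e.g. $S=\mathbb N^r\setminus\{0\}$). Put $S^*=\bigsqcup_{n\ge1}S^n$. A collection is a map $F:S^*\to\mathbb Q$. The plethysm of collections $F,G$ is $$(F\circ G)(\alpha)=\sum_{\pi}F(\pi_*\alpha)\prod_{j=1}^mG(\alpha|_{\pi^{-1}(j)}),\qquad\alpha\in S^n,$$ where the sum runs over all $m\ge1$ and all order-preserving surjections $\pi:\{1,\dots,n\}\to\{1,\dots,m\}$, $(\pi_*\alpha)_j=\sum_{i\in\pi^{-1}(j)}\alpha_i$, and $\alpha|_{\pi^{-1}(j)}$ is the restricted tuple. The identity collection $\mathbf 1$ takes value $1$ on $S^1$ and $0$ on $S^n$, $n>1$; plethysm is associative with unit $\mathbf 1$. Every collection with value $1$ on all elements of $S=S^1$ has a two-sided inverse with respect to $\circ$. A (weak) stability $\le$ on $S$ is a preorder (a transitive relation with any two elements comparable) such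 that for any $a,b\in S$ either $a\le a+b\le b$ or $b\le a+b\le a$. Write $a<b$ if $a\le b$ and $b\not\le a$. The Harder–Narasimhan collection of $\le$ is $s:S^*\to\mathbb Q$ with $s(\alpha)=1$ if $\alpha_1>\dots>\alpha_n$ and $s(\alpha)=0$ otherwise, for $\alpha\in S^n$. *)

theory Defs
  imports Complex_Main "HOL-Library.FuncSet"
begin

text \<open>
  The semigroup \<open>S\<close> is a type of class \<^class>\<open>ab_semigroup_add\<close> (no zero is assumed), and
  \<open>S\<^sup>n\<close> is the set of lists of length \<open>n\<close>, so that tuples are indexed from 0 rather than from 1.
\<close>

fun semigroup_sum :: "'a::ab_semigroup_add list \<Rightarrow> 'a" where
  "semigroup_sum [] = undefined"
| "semigroup_sum [x] = x"
| "semigroup_sum (x # y # xs) = x + semigroup_sum (y # xs)"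

definition stability :: "('a::ab_semigroup_add \<Rightarrow> 'a \<Rightarrow> bool) \<Rightarrow> bool" where
  "stability le \<longleftrightarrow>
     transp le \<and>
     (\<forall>a b. le a b \<or> le b a) \<and>
     (\<forall>a b. (le a (a + b) \<and> le (a + b) b) \<or> (le b (a + b) \<and> le (a + b) a))"

definition strictly_less :: "('a \<Rightarrow> 'a \<Rightarrow> bool) \<Rightarrow> 'a \<Rightarrow> 'a \<Rightarrow> bool" where
  "strictly_less le a b \<longleftrightarrow> le a b \<and> \<not> le b a"

text \<open>
  A collection is only meaningful on nonempty lists. The normalisation at the empty list puts
  these functions in bijection with the maps from the disjoint union of the \<open>S\<^sup>n\<close>, \<open>n \<ge> 1\<close>, to the
  rationals, so that equality of collections is equality of functions. Plethysm, its unit and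
  the Harder--Narasimhan collection below all satisfy it.
\<close>

definition collections :: "('a list \<Rightarrow> rat) set" where
  "collections = {F. F [] = 0}"

definition order_preserving_surjections :: "nat \<Rightarrow> nat \<Rightarrow> (nat \<Rightarrow> nat) set" where
  "order_preserving_surjections n m =
     {\<pi> \<in> {..<n} \<rightarrow>\<^sub>E {..<m}. mono_on {..<n} \<pi> \<and> \<pi> ` {..<n} = {..<m}}"

definition restrict_fibre :: "(nat \<Rightarrow> nat) \<Rightarrow> nat \<Rightarrow> 'a list \<Rightarrow> 'a list" where
  "restrict_fibre \<pi> j \<alpha> = nths \<alpha> {i. i < length \<alpha> \<and> \<pi> i = j}"

definition pushforward :: "(nat \<Rightarrow> nat) \<Rightarrow> nat \<Rightarrow> 'a::ab_semigroup_add list \<Rightarrow> 'a list" where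
  "pushforward \<pi> m \<alpha> = map (\<lambda>j. semigroup_sum (restrict_fibre \<pi> j \<alpha>)) [0..<m]"

text \<open>For \<open>m > n\<close> there are no surjections, so \<open>m\<close> may be bounded by the length.\<close>

definition plethysm ::
  "('a::ab_semigroup_add list \<Rightarrow> rat) \<Rightarrow> ('a list \<Rightarrow> rat) \<Rightarrow> 'a list \<Rightarrow> rat" where
  "plethysm F G \<alpha> =
     (\<Sum>m = 1..length \<alpha>. \<Sum>\<pi>\<in>order_preserving_surjections (length \<alpha>) m.
        F (pushforward \<pi> m \<alpha>) * (\<Prod>j<m. G (restrict_fibre \<pi> j \<alpha>)))"

definition identity_collection :: "'a list \<Rightarrow> rat" where
  "identity_collection \<alpha> = (if length \<alpha> = 1 then 1 else 0)"

definition plethysm_inverse :: "('a::ab_semigroup_add list \<Rightarrow> rat) \<Rightarrow> 'a list \<Rightarrow> rat" where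
  "plethysm_inverse F =
     (THE G. G \<in> collections \<and> plethysm F G = identity_collection \<and>
             plethysm G F = identity_collection)"

definition HN_collection :: "('a \<Rightarrow> 'a \<Rightarrow> bool) \<Rightarrow> 'a list \<Rightarrow> rat" where
  "HN_collection le \<alpha> =
     (if \<alpha> \<noteq> [] \<and> successively (\<lambda>a b. strictly_less le b a) \<alpha> then 1 else 0)"

end

theory Submission
  imports Defs
begin

text \<open>
  An order-preserving surjection from \<open>{1, \<dots>, n}\<close> is the same as a way of cutting a tuple \<open>\<alpha>\<close>
  of length \<open>n\<close> into consecutive nonempty blocks, so plethysm is a sum over the compositions of
  \<open>\<alpha>\<close> into blocks (\<open>plethysm_compositions\<close>). In this form it is associative, because both ways of
  bracketing sum over compositions of compositions (\<open>plethysm_assoc\<close>). A collection with value 1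
  on all singletons can be cancelled on the left by induction on the length, because the
  composition with one block contributes the value of the right factor at \<open>\<alpha>\<close> itself
  (\<open>plethysm_left_cancel\<close>). Together these two facts turn a left inverse with value 1 on
  singletons into the unique two-sided inverse (\<open>plethysm_inverse_eqI\<close>). It therefore suffices
  to define a collection \<open>t\<close> by the claimed formula and to prove \<open>t \<circ> s = 1\<close>; this order of the
  factors is the convenient one.

  Write \<open>p\<^sub>k\<close> for the sum of the first \<open>k\<close> entries of \<open>\<alpha>\<close> and \<open>q\<^sub>k\<close> for the sum of the others. A
  composition of \<open>\<alpha>\<close> is determined by its set \<open>D \<subseteq> {1, \<dots>, n - 1}\<close> of cut positions, and both
  factors of its term in \<open>(t \<circ> s)(\<alpha>)\<close> are products over positions: \<open>t\<close> of the block sums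
  contributes \<open>- [p\<^sub>k > q\<^sub>k]\<close> for every cut \<open>k \<in> D\<close>, and \<open>s\<close> of the blocks contributes
  \<open>[\<alpha>\<^sub>k > \<alpha>\<^sub>k\<^sub>+\<^sub>1]\<close> for every \<open>k \<notin> D\<close>. Summing over all \<open>D\<close> shows that \<open>(t \<circ> s)(\<alpha>)\<close> is the product
  of \<open>[\<alpha>\<^sub>k > \<alpha>\<^sub>k\<^sub>+\<^sub>1] - [p\<^sub>k > q\<^sub>k]\<close> over \<open>1 \<le> k < n\<close>. For \<open>n = 1\<close> this is 1. For \<open>n > 1\<close> some factor
  vanishes; this is the only place where the axioms of a stability are used
  (\<open>exists_cut_agreeing\<close>).
\<close>

section \<open>Plethysm as a sum over compositions\<close>

definition compositions :: "'a list \<Rightarrow> 'a list list set" where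
  "compositions xs = {bs. concat bs = xs \<and> [] \<notin> set bs}"

lemma semigroup_sum_Cons: "xs \<noteq> [] \<Longrightarrow> semigroup_sum (x # xs) = x + semigroup_sum xs"
  by (cases xs) auto

lemma semigroup_sum_append:
  "xs \<noteq> [] \<Longrightarrow> ys \<noteq> [] \<Longrightarrow> semigroup_sum (xs @ ys) = semigroup_sum xs + semigroup_sum ys"
  by (induction xs rule: semigroup_sum.induct) (auto simp: semigroup_sum_Cons add.assoc)

lemma concat_eq_Nil_if_no_empty_block: "[] \<notin> set bs \<Longrightarrow> concat bs = [] \<longleftrightarrow> bs = []"
  by (cases bs) auto

lemma semigroup_sum_concat:
  "bs \<noteq> [] \<Longrightarrow> [] \<notin> set bs \<Longrightarrow> semigroup_sum (map semigroup_sum bs) = semigroup_sum (concat bs)"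
proof (induction bs)
  case (Cons b bs)
  then show ?case
    by (cases "bs = []") (auto simp: semigroup_sum_Cons semigroup_sum_append
        concat_eq_Nil_if_no_empty_block simp del: concat_eq_Nil_conv)
qed simp

lemma compositions_Nil: "compositions [] = {[]}"
  using concat_eq_Nil_if_no_empty_block by (auto simp: compositions_def simp del: concat_eq_Nil_conv)

lemma compositions_singleton: "compositions [x] = {[[x]]}"
proof -
  have "cs = [[x]]" if cs: "concat cs = [x]" "[] \<notin> set cs" for cs
  proof -
    obtain c ds where "cs = c # ds" "c @ concat ds = [x]" "c \<noteq> []"
      using cs by (cases cs) auto
    moreover from this have "c = [x]" "concat ds = []" by (cases c; simp)+
    moreover have "ds = []"
      using calculation cs concat_eq_Nil_if_no_empty_block[of ds] by simp
    ultimately show ?thesis by simp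
  qed
  then show ?thesis by (auto simp: compositions_def)
qed

text \<open>
  The first entry either is a block of its own or is glued to the first block of the remainder.
\<close>

lemma compositions_Cons:
  assumes "xs \<noteq> []"
  shows "compositions (x # xs) =
    (\<lambda>bs. [x] # bs) ` compositions xs \<union> (\<lambda>bs. (x # hd bs) # tl bs) ` compositions xs"
    (is "_ = ?A \<union> ?B")
proof
  show "compositions (x # xs) \<subseteq> ?A \<union> ?B"
  proof
    fix cs assume "cs \<in> compositions (x # xs)"
    then have cs: "concat cs = x # xs" "[] \<notin> set cs" by (auto simp: compositions_def)
    then obtain b bs where 1: "cs = (x # b) # bs" "b @ concat bs = xs"
      by (cases cs; cases "hd cs") auto
    show "cs \<in> ?A \<union> ?B"
    proof (cases "b = []")
      case True
      then show ?thesis using 1 cs by (auto simp: compositions_def)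
    next
      case False
      then have "b # bs \<in> compositions xs" using 1 cs by (auto simp: compositions_def)
      then show ?thesis using 1 by (auto intro!: image_eqI[of _ _ "b # bs"])
    qed
  qed
  have *: "hd bs @ concat (tl bs) = xs" "[] \<notin> set (tl bs)" if "bs \<in> compositions xs" for bs
    using that assms by (cases bs; auto simp: compositions_def)+
  show "?A \<union> ?B \<subseteq> compositions (x # xs)"
    using * by (auto simp: compositions_def)
qed

lemma finite_compositions: "finite (compositions xs)"
proof (induction xs)
  case (Cons x xs)
  show ?case
  proof (cases "xs = []")
    case True
    then show ?thesis by (simp add: compositions_singleton)
  next
    case False
    then show ?thesis using Cons by (simp add: compositions_Cons)
  qed
qed (simp add: compositions_Nil)

text \<open>
  Selecting entries by position respects order, so two selections concatenate if all positions of
  the first precede those of the second. For the fibres of a monotone map this is always the case.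
\<close>

lemma nths_Un_less:
  assumes "\<And>a b. a \<in> A \<Longrightarrow> b \<in> B \<Longrightarrow> a < b"
  shows "nths xs (A \<union> B) = nths xs A @ nths xs B"
  using assms
proof (induction xs arbitrary: A B)
  case (Cons x xs)
  have "nths xs ({j. Suc j \<in> A} \<union> {j. Suc j \<in> B}) = nths xs {j. Suc j \<in> A} @ nths xs {j. Suc j \<in> B}"
    using Cons.prems by (intro Cons.IH) auto
  moreover have "{j. Suc j \<in> A \<union> B} = {j. Suc j \<in> A} \<union> {j. Suc j \<in> B}" by auto
  moreover have "A = {}" if "0 \<in> B" using Cons.prems that by fastforce
  ultimately show ?case by (auto simp: nths_Cons)
qed simp

lemma concat_restrict_fibre:
  assumes "mono_on {..<length \<alpha>} \<pi>"
  shows "concat (map (\<lambda>j. restrict_fibre \<pi> j \<alpha>) [0..<k]) = nths \<alpha> {i. i < length \<alpha> \<and> \<pi> i < k}"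
proof (induction k)
  case (Suc k)
  let ?n = "length \<alpha>"
  have "{i. i < ?n \<and> \<pi> i < Suc k} = {i. i < ?n \<and> \<pi> i < k} \<union> {i. i < ?n \<and> \<pi> i = k}" by auto
  moreover have "nths \<alpha> ({i. i < ?n \<and> \<pi> i < k} \<union> {i. i < ?n \<and> \<pi> i = k}) =
      nths \<alpha> {i. i < ?n \<and> \<pi> i < k} @ nths \<alpha> {i. i < ?n \<and> \<pi> i = k}"
  proof (rule nths_Un_less)
    fix a b assume "a \<in> {i. i < ?n \<and> \<pi> i < k}" "b \<in> {i. i < ?n \<and> \<pi> i = k}"
    then show "a < b" using mono_onD[OF assms, of b a] by (cases "a < b") auto
  qed
  ultimately show ?case using Suc by (simp add: restrict_fibre_def)
qed simp

definition fibres :: "'a list \<Rightarrow> nat \<times> (nat \<Rightarrow> nat) \<Rightarrow> 'a list list" where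
  "fibres \<alpha> = (\<lambda>(m, \<pi>). map (\<lambda>j. restrict_fibre \<pi> j \<alpha>) [0..<m])"

text \<open>
  The set of positions that a monotone map sends below \<open>k\<close> is an initial segment, whose length is
  the total length of the first \<open>k\<close> fibres. Hence the fibres determine the map.
\<close>

lemma inj_on_fibres:
  "inj_on (fibres \<alpha>) (SIGMA m:{1..length \<alpha>}. order_preserving_surjections (length \<alpha>) m)"
proof (rule inj_onI, clarsimp simp del: One_nat_def)
  fix m \<pi> m' \<pi>'
  let ?n = "length \<alpha>"
  assume \<pi>: "\<pi> \<in> order_preserving_surjections ?n m"
    and \<pi>': "\<pi>' \<in> order_preserving_surjections ?n m'"
    and eq: "fibres \<alpha> (m, \<pi>) = fibres \<alpha> (m', \<pi>')"
  have m: "m' = m" using arg_cong[OF eq, of length] by (simp add: fibres_def)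
  have mono: "mono_on {..<?n} \<pi>" "mono_on {..<?n} \<pi>'"
    using \<pi> \<pi>' by (auto simp: order_preserving_surjections_def)
  \<comment> \<open>Entries of \<open>\<alpha>\<close> may coincide, so positions are recovered from the length of the selection.\<close>
  have initial: "{i. i < ?n \<and> p i < k} = {..<length (nths \<alpha> {i. i < ?n \<and> p i < k})}"
    if "mono_on {..<?n} p" for p :: "nat \<Rightarrow> nat" and k
  proof -
    let ?A = "{i. i < ?n \<and> p i < k}"
    have down: "j \<in> ?A" if "i \<in> ?A" "j \<le> i" for i j
      using that mono_onD[OF \<open>mono_on {..<?n} p\<close>, of j i] by auto
    have "\<exists>c. ?A = {..<c}"
    proof (cases "?A = {}")
      case False
      have "finite ?A" by simp
      then have "Max ?A \<in> ?A" "\<And>i. i \<in> ?A \<Longrightarrow> i \<le> Max ?A" using False Max_in Max_ge by blast+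
      then have "?A = {..Max ?A}" using down by blast
      then have "?A = {..<Suc (Max ?A)}" by (simp only: lessThan_Suc_atMost)
      then show ?thesis by blast
    qed (auto intro!: exI[of _ 0])
    then obtain c where c: "?A = {..<c}" by blast
    have "{i. i < ?n \<and> i \<in> ?A} = ?A" by auto
    then have "length (nths \<alpha> ?A) = card ?A" by (simp add: length_nths)
    then show ?thesis by (simp add: c)
  qed
  have lt_iff: "\<pi> i < k \<longleftrightarrow> \<pi>' i < k" if "i < ?n" "k \<le> m" for i k
  proof -
    have "concat (take k (fibres \<alpha> (m, \<pi>))) = concat (take k (fibres \<alpha> (m', \<pi>')))"
      using eq by simp
    then have "nths \<alpha> {i. i < ?n \<and> \<pi> i < k} = nths \<alpha> {i. i < ?n \<and> \<pi>' i < k}"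
      using that m mono by (simp add: fibres_def take_map concat_restrict_fibre)
    then have "{i. i < ?n \<and> \<pi> i < k} = {i. i < ?n \<and> \<pi>' i < k}"
      using initial[OF mono(1), of k] initial[OF mono(2), of k] by argo
    then show ?thesis using that by auto
  qed
  have "\<pi> i = \<pi>' i" for i
  proof (cases "i < ?n")
    case True
    then have "\<pi> i < m" "\<pi>' i < m"
      using \<pi> \<pi>' m by (auto simp: order_preserving_surjections_def)
    then show ?thesis
      using lt_iff[OF True, of "\<pi> i"] lt_iff[OF True, of "\<pi>' i"] by simp
  next
    case False
    then show ?thesis using \<pi> \<pi>'
      by (auto simp: order_preserving_surjections_def PiE_def extensional_def)
  qed
  then show "m = m' \<and> \<pi> = \<pi>'" using m by auto
qed

lemma fibres_mem_compositions:
  assumes "\<pi> \<in> order_preserving_surjections (length \<alpha>) m"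
  shows "fibres \<alpha> (m, \<pi>) \<in> compositions \<alpha>"
proof -
  let ?n = "length \<alpha>"
  have mono: "mono_on {..<?n} \<pi>" and im: "\<pi> ` {..<?n} = {..<m}"
    using assms by (auto simp: order_preserving_surjections_def)
  have 1: "concat (fibres \<alpha> (m, \<pi>)) = \<alpha>"
    using im by (auto simp: fibres_def concat_restrict_fibre[OF mono] intro!: nths_all)
  have 2: "[] \<noteq> restrict_fibre \<pi> j \<alpha>" if "j < m" for j
  proof -
    obtain i where "i < ?n" "\<pi> i = j" using im \<open>j < m\<close> by (metis imageE lessThan_iff)
    then have "\<alpha> ! i \<in> set (restrict_fibre \<pi> j \<alpha>)" by (auto simp: restrict_fibre_def set_nths)
    then show ?thesis by auto
  qed
  have "[] \<notin> set (fibres \<alpha> (m, \<pi>))" using 2 by (simp add: fibres_def image_iff)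
  with 1 show ?thesis by (simp add: compositions_def)
qed

text \<open>
  A composition arises from the map that sends a position to the index of its block. If the block
  with index \<open>k\<close> starts at position \<open>p k\<close>, then a position \<open>i\<close> is sent below \<open>k\<close> exactly if
  \<open>i < p k\<close>; everything else about the map follows from this equivalence.
\<close>

lemma compositions_subset_fibres:
  assumes bs: "bs \<in> compositions \<alpha>" and "\<alpha> \<noteq> []"
  shows "bs \<in> fibres \<alpha> ` (SIGMA m:{1..length \<alpha>}. order_preserving_surjections (length \<alpha>) m)"
proof -
  let ?n = "length \<alpha>" and ?m = "length bs"
  define p where "p k = length (concat (take k bs))" for k
  have cat: "concat bs = \<alpha>" and ne: "[] \<notin> set bs" using bs by (auto simp: compositions_def)
  have bs_ne: "bs \<noteq> []" using cat \<open>\<alpha> \<noteq> []\<close> by auto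
  have p_Suc: "p k < p (Suc k)" if "k < ?m" for k
  proof -
    have "bs ! k \<noteq> []" using ne that by (metis nth_mem)
    then show ?thesis using that by (simp add: p_def take_Suc_conv_app_nth)
  qed
  have p0: "p 0 = 0" and pm: "p ?m = ?n" by (simp_all add: p_def cat)
  have p_mono: "p k \<le> p l" if kl: "k \<le> l" for k l
  proof -
    obtain d where "l = k + d" using le_Suc_ex[OF kl] by blast
    then show ?thesis by (simp add: p_def take_add)
  qed
  define \<pi> where "\<pi> = (\<lambda>i\<in>{..<?n}. LEAST k. i < p (Suc k))"
  have \<pi>_less: "\<pi> i < k \<longleftrightarrow> i < p k" if "i < ?n" for i k
  proof
    have \<pi>i: "\<pi> i = (LEAST k. i < p (Suc k))" using that by (simp add: \<pi>_def)
    have "i < p (Suc (?m - 1))" using that pm bs_ne by simp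
    then have least: "i < p (Suc (\<pi> i))" unfolding \<pi>i by (rule LeastI)
    show "i < p k" if "\<pi> i < k" using least p_mono[of "Suc (\<pi> i)" k] that by simp
    show "\<pi> i < k" if "i < p k"
    proof (cases k)
      case (Suc l)
      then have "\<pi> i \<le> l" unfolding \<pi>i using that by (intro Least_le) simp
      then show ?thesis using Suc by simp
    qed (use that p0 in simp)
  qed
  have bound: "\<pi> i < ?m" if "i < ?n" for i using \<pi>_less that pm by simp
  have mono: "mono_on {..<?n} \<pi>"
  proof (rule mono_onI)
    fix i j assume "i \<in> {..<?n}" "j \<in> {..<?n}" "i \<le> j"
    then show "\<pi> i \<le> \<pi> j" using \<pi>_less[of i "Suc (\<pi> j)"] \<pi>_less[of j "Suc (\<pi> j)"] by simp
  qed
  have "j \<in> \<pi> ` {..<?n}" if "j < ?m" for j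
  proof -
    have "p j < ?n" using p_Suc[OF that] p_mono[of "Suc j" ?m] that pm by simp
    moreover have "\<pi> (p j) = j"
      using \<pi>_less[OF calculation, of j] \<pi>_less[OF calculation, of "Suc j"] p_Suc[OF that] by simp
    ultimately show ?thesis by force
  qed
  then have \<pi>: "\<pi> \<in> order_preserving_surjections ?n ?m"
    using bound mono by (auto simp: order_preserving_surjections_def \<pi>_def)
  have "length (fibres \<alpha> (?m, \<pi>)) = ?m" by (simp add: fibres_def)
  moreover have "fibres \<alpha> (?m, \<pi>) ! j = bs ! j" if "j < ?m" for j
  proof -
    have take: "concat (map (\<lambda>j. restrict_fibre \<pi> j \<alpha>) [0..<k]) = concat (take k bs)" if "k \<le> ?m" for k
    proof -
      have "{i. i < ?n \<and> \<pi> i < k} = {..<p k}"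
        using \<pi>_less p_mono[OF that] pm by auto
      then have "concat (map (\<lambda>j. restrict_fibre \<pi> j \<alpha>) [0..<k]) = take (p k) \<alpha>"
        by (simp add: concat_restrict_fibre[OF mono])
      also have "\<dots> = concat (take k bs)"
      proof -
        have "\<alpha> = concat (take k bs) @ concat (drop k bs)"
          by (metis cat append_take_drop_id concat_append)
        then show ?thesis by (simp add: p_def)
      qed
      finally show ?thesis .
    qed
    show ?thesis using take[of j] take[of "Suc j"] that
      by (simp add: take_Suc_conv_app_nth fibres_def)
  qed
  ultimately have "fibres \<alpha> (?m, \<pi>) = bs" by (simp add: list_eq_iff_nth_eq)
  moreover have "?m \<le> ?n"
  proof -
    have "\<pi> ` {..<?n} = {..<?m}" using \<pi> by (simp add: order_preserving_surjections_def)
    then show ?thesis by (metis card_image_le card_lessThan finite_lessThan)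
  qed
  moreover have "1 \<le> ?m" using bs_ne by (cases bs) auto
  ultimately show ?thesis using \<pi> by force
qed

lemma bij_betw_fibres:
  assumes "\<alpha> \<noteq> []"
  shows "bij_betw (fibres \<alpha>)
    (SIGMA m:{1..length \<alpha>}. order_preserving_surjections (length \<alpha>) m) (compositions \<alpha>)"
  unfolding bij_betw_def
  using inj_on_fibres fibres_mem_compositions compositions_subset_fibres[OF _ assms] by fastforce

lemma finite_order_preserving_surjections: "finite (order_preserving_surjections n m)"
  by (rule finite_subset[of _ "{..<n} \<rightarrow>\<^sub>E {..<m}"])
    (auto simp: order_preserving_surjections_def intro: finite_PiE)

lemma prod_list_map_upt: "prod_list (map g [0..<m]) = prod g {..<m}"
  for g :: "nat \<Rightarrow> 'a::comm_monoid_mult"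
  by (induction m) (simp_all add: mult.commute)

lemma plethysm_Nil: "plethysm F G [] = 0"
  by (simp add: plethysm_def)

text \<open>
  The empty list is special: it has the composition without blocks, which the sum over the
  surjections onto \<open>m \<ge> 1\<close> points does not see.
\<close>

lemma plethysm_compositions:
  assumes "\<alpha> \<noteq> []"
  shows "plethysm F G \<alpha> =
    (\<Sum>bs\<in>compositions \<alpha>. F (map semigroup_sum bs) * prod_list (map G bs))"
proof -
  let ?h = "\<lambda>bs. F (map semigroup_sum bs) * prod_list (map G bs)"
  have "?h (fibres \<alpha> (m, \<pi>)) =
      F (pushforward \<pi> m \<alpha>) * (\<Prod>j<m. G (restrict_fibre \<pi> j \<alpha>))" for m \<pi>
    by (simp add: fibres_def pushforward_def comp_def prod_list_map_upt)
  then have "plethysm F G \<alpha> = (\<Sum>(m, \<pi>)\<in>(SIGMA m:{1..length \<alpha>}.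
      order_preserving_surjections (length \<alpha>) m). ?h (fibres \<alpha> (m, \<pi>)))"
    by (simp add: plethysm_def sum.Sigma finite_order_preserving_surjections)
  also have "\<dots> = sum ?h (compositions \<alpha>)"
    using sum.reindex_bij_betw[OF bij_betw_fibres[OF assms], of ?h] by (simp add: case_prod_unfold)
  finally show ?thesis .
qed

section \<open>Associativity and cancellation\<close>

lemma finite_set_Cons: "finite A \<Longrightarrow> finite B \<Longrightarrow> finite (set_Cons A B)"
  by (rule finite_subset[of _ "(\<lambda>(x, xs). x # xs) ` (A \<times> B)"]) (auto simp: set_Cons_def)

lemma finite_listset: "(\<And>A. A \<in> set As \<Longrightarrow> finite A) \<Longrightarrow> finite (listset As)"
  by (induction As) (auto intro: finite_set_Cons)

text \<open>
  Expansion of a product of sums: a term is given by a choice from every factor.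
\<close>

lemma prod_list_sum:
  fixes w :: "'b \<Rightarrow> 'c::comm_semiring_1"
  shows "prod_list (map (\<lambda>x. sum w (C x)) xs) = (\<Sum>ys\<in>listset (map C xs). prod_list (map w ys))"
proof (induction xs)
  case (Cons x xs)
  have "prod_list (map (\<lambda>x. sum w (C x)) (x # xs)) =
      (\<Sum>(y, ys)\<in>C x \<times> listset (map C xs). w y * prod_list (map w ys))"
    by (simp add: Cons sum_product sum.cartesian_product)
  also have "\<dots> = (\<Sum>ys\<in>listset (map C (x # xs)). prod_list (map w ys))"
    by (rule sum.reindex_bij_witness[of _ "\<lambda>ys. (hd ys, tl ys)" "\<lambda>(y, ys). y # ys"])
      (auto simp: set_Cons_def)
  finally show ?case .
qed simp

lemma listset_compositions:
  "listset (map compositions ds) = {cs. map concat cs = ds \<and> (\<forall>c\<in>set cs. [] \<notin> set c)}"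
proof (induction ds)
  case (Cons d ds)
  then show ?case by (auto simp: set_Cons_def compositions_def)
qed auto

lemma compositions_map: "compositions (map f xs) = map (map f) ` compositions xs"
proof
  show "map (map f) ` compositions xs \<subseteq> compositions (map f xs)"
    by (auto simp: compositions_def map_concat)
  have "\<exists>bs. map (map f) bs = cs \<and> concat bs = xs"
    if "concat cs = map f xs" for cs
    using that
  proof (induction cs arbitrary: xs)
    case (Cons c cs)
    then obtain ys zs where "xs = ys @ zs" "map f ys = c" "map f zs = concat cs"
      by (metis append_eq_map_conv concat.simps(2))
    moreover from this obtain bs where "map (map f) bs = cs" "concat bs = zs"
      using Cons.IH[of zs] by auto
    ultimately show ?case by (intro exI[of _ "ys # bs"]) auto
  qed simp
  then show "compositions (map f xs) \<subseteq> map (map f) ` compositions xs"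
    by (fastforce simp: compositions_def)
qed

text \<open>
  The map \<open>f\<close> may identify entries, but it keeps the lengths of the blocks, and these determine a
  composition of a fixed list.
\<close>

lemma inj_on_map_compositions: "inj_on (map (map f)) (compositions xs)"
proof (rule inj_onI)
  fix bs cs assume "bs \<in> compositions xs" "cs \<in> compositions xs" and eq: "map (map f) bs = map (map f) cs"
  then have "concat bs = concat cs" by (simp add: compositions_def)
  moreover have len: "length bs = length cs" using arg_cong[OF eq, of length] by simp
  moreover have "length x = length y" if xy: "(x, y) \<in> set (zip bs cs)" for x y
  proof -
    obtain i where "i < length bs" "i < length cs" "x = bs ! i" "y = cs ! i"
      using xy by (auto simp: in_set_zip)
    then show ?thesis using arg_cong[OF eq, of "\<lambda>l. length (l ! i)"] by simp
  qed
  ultimately show "bs = cs" using concat_eq_concat_iff[of bs cs] by auto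
qed

lemma prod_list_map_mult:
  fixes f g :: "'a \<Rightarrow> 'b::comm_monoid_mult"
  shows "prod_list (map (\<lambda>x. f x * g x) xs) = prod_list (map f xs) * prod_list (map g xs)"
  by (induction xs) (simp_all add: ac_simps)

lemma prod_list_concat: "prod_list (concat xss) = prod_list (map prod_list xss)"
  for xss :: "'a::monoid_mult list list"
  by (induction xss) auto

lemma concat_map_concat: "concat (map concat xsss) = concat (concat xsss)"
  by (induction xsss) auto

text \<open>
  Both sides are sums over the lists of lists of blocks that flatten to \<open>\<alpha>\<close>. On the left, the outer
  sum chooses all the small blocks and the inner one groups them; on the right, the outer sum
  chooses the large blocks and every large block is then subdivided on its own. The terms agree
  because the sum of a large block is the sum of the sums of its small blocks.
\<close>

lemma plethysm_assoc: "plethysm (plethysm F G) H = plethysm F (plethysm G H)"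
proof
  fix \<alpha> :: "'a list"
  let ?\<sigma> = "semigroup_sum :: 'a list \<Rightarrow> 'a"
  show "plethysm (plethysm F G) H \<alpha> = plethysm F (plethysm G H) \<alpha>"
  proof (cases "\<alpha> = []")
    case False
    define W where "W = (\<lambda>cs. F (map (?\<sigma> \<circ> concat) cs) *
      (prod_list (map (\<lambda>c. G (map ?\<sigma> c) * prod_list (map H c)) cs)))"
    let ?N = "{cs. concat (concat cs) = \<alpha> \<and> [] \<notin> set cs \<and> [] \<notin> set (concat cs)}"
    have left: "plethysm F G (map ?\<sigma> bs) * prod_list (map H bs) = sum W (compositions bs)"
      if bs: "bs \<in> compositions \<alpha>" for bs
    proof -
      have "bs \<noteq> []" using bs False by (auto simp: compositions_def)
      have "F (map ?\<sigma> (map (map ?\<sigma>) cs)) * prod_list (map G (map (map ?\<sigma>) cs)) *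
          prod_list (map H bs) = W cs" if cs: "cs \<in> compositions bs" for cs
      proof -
        have "concat cs = bs" "[] \<notin> set cs" using cs by (auto simp: compositions_def)
        have "?\<sigma> (map ?\<sigma> c) = ?\<sigma> (concat c)" if "c \<in> set cs" for c
          using that bs \<open>concat cs = bs\<close> \<open>[] \<notin> set cs\<close>
          by (intro semigroup_sum_concat) (auto simp: compositions_def)
        then have "F (map ?\<sigma> (map (map ?\<sigma>) cs)) = F (map (?\<sigma> \<circ> concat) cs)"
          by (intro arg_cong[of _ _ F]) simp
        moreover have "prod_list (map H bs) = prod_list (map (\<lambda>c. prod_list (map H c)) cs)"
          unfolding \<open>concat cs = bs\<close>[symmetric]
          by (simp add: map_concat prod_list_concat comp_def)
        ultimately show ?thesis by (simp add: W_def prod_list_map_mult comp_def)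
      qed
      then show ?thesis using \<open>bs \<noteq> []\<close>
        by (simp add: plethysm_compositions compositions_map sum.reindex[OF inj_on_map_compositions]
            sum_distrib_right)
    qed
    have right: "F (map ?\<sigma> ds) * prod_list (map (plethysm G H) ds) =
        sum W (listset (map compositions ds))" if ds: "ds \<in> compositions \<alpha>" for ds
    proof -
      have "map (plethysm G H) ds =
          map (\<lambda>d. \<Sum>c\<in>compositions d. G (map ?\<sigma> c) * prod_list (map H c)) ds"
      proof (rule map_cong[OF refl])
        fix d assume "d \<in> set ds"
        then have "d \<noteq> []" using ds by (auto simp: compositions_def)
        then show "plethysm G H d = (\<Sum>c\<in>compositions d. G (map ?\<sigma> c) * prod_list (map H c))"
          by (rule plethysm_compositions)
      qed
      then have "F (map ?\<sigma> ds) * prod_list (map (plethysm G H) ds) =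
          (\<Sum>cs\<in>listset (map compositions ds).
            F (map ?\<sigma> ds) * prod_list (map (\<lambda>c. G (map ?\<sigma> c) * prod_list (map H c)) cs))"
        by (simp only: prod_list_sum sum_distrib_left)
      also have "\<dots> = sum W (listset (map compositions ds))"
        by (intro sum.cong refl) (auto simp: W_def listset_compositions)
      finally show ?thesis .
    qed
    have no_empty_iff: "[] \<in> concat ` set cs \<longleftrightarrow> [] \<in> set cs"
      if "\<forall>c\<in>set cs. [] \<notin> set c" for cs :: "'a list list list"
    proof
      assume "[] \<in> concat ` set cs"
      then obtain c where "c \<in> set cs" "concat c = []" by (metis imageE)
      then show "[] \<in> set cs" using that concat_eq_Nil_if_no_empty_block by blast
    qed force
    have "plethysm (plethysm F G) H \<alpha> = (\<Sum>bs\<in>compositions \<alpha>. sum W (compositions bs))"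
      using False left by (simp add: plethysm_compositions)
    also have "\<dots> = (\<Sum>(bs, cs)\<in>Sigma (compositions \<alpha>) compositions. W cs)"
      by (simp add: sum.Sigma finite_compositions)
    also have "\<dots> = sum W ?N"
      by (rule sum.reindex_bij_witness[of _ "\<lambda>cs. (concat cs, cs)" snd])
        (auto simp: compositions_def)
    also have "\<dots> = (\<Sum>(ds, cs)\<in>Sigma (compositions \<alpha>) (\<lambda>ds. listset (map compositions ds)). W cs)"
      by (rule sum.reindex_bij_witness[of _ snd "\<lambda>cs. (map concat cs, cs)"])
        (auto simp: compositions_def listset_compositions concat_map_concat no_empty_iff)
    also have "\<dots> = (\<Sum>ds\<in>compositions \<alpha>. sum W (listset (map compositions ds)))"
      by (rule sum.Sigma[symmetric])
        (auto simp: finite_compositions intro!: finite_listset)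
    also have "\<dots> = plethysm F (plethysm G H) \<alpha>"
      using False right by (simp add: plethysm_compositions)
    finally show ?thesis .
  qed (simp add: plethysm_Nil)
qed

lemma length_block_less:
  assumes "bs \<in> compositions \<alpha>" "bs \<noteq> [\<alpha>]" "b \<in> set bs"
  shows "length b < length \<alpha>"
proof -
  obtain us vs where bs: "bs = us @ b # vs" using assms(3) by (meson split_list)
  have "us \<noteq> [] \<or> vs \<noteq> []"
    using assms bs by (auto simp: compositions_def)
  moreover have "[] \<notin> set us" "[] \<notin> set vs" using assms(1) bs by (auto simp: compositions_def)
  ultimately have "concat us \<noteq> [] \<or> concat vs \<noteq> []"
    using concat_eq_Nil_if_no_empty_block by metis
  then show ?thesis using assms(1) bs by (auto simp: compositions_def)
qed

lemma singleton_mem_compositions: "\<alpha> \<noteq> [] \<Longrightarrow> [\<alpha>] \<in> compositions \<alpha>"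
  by (simp add: compositions_def)

lemma singletons_mem_compositions: "map (\<lambda>x. [x]) \<alpha> \<in> compositions \<alpha>"
  by (auto simp: compositions_def)

text \<open>
  The composition of \<open>\<alpha>\<close> with the single block \<open>\<alpha>\<close> contributes \<open>G \<alpha>\<close> to \<open>plethysm F G \<alpha>\<close>, and
  all other terms involve \<open>G\<close> on shorter lists only.
\<close>

lemma plethysm_left_cancel:
  assumes F: "\<And>x. F [x] = 1"
    and G: "G \<in> collections" and G': "G' \<in> collections"
    and eq: "plethysm F G = plethysm F G'"
  shows "G = G'"
proof
  fix \<alpha> show "G \<alpha> = G' \<alpha>"
  proof (induction \<alpha> rule: length_induct)
    case (1 \<alpha>)
    show ?case
    proof (cases "\<alpha> = []")
      case False
      have split: "plethysm F E \<alpha> = E \<alpha> +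
          (\<Sum>bs\<in>compositions \<alpha> - {[\<alpha>]}. F (map semigroup_sum bs) * prod_list (map E bs))" for E
        using False by (simp add: plethysm_compositions F finite_compositions
            singleton_mem_compositions sum.remove[of _ "[\<alpha>]"])
      have "prod_list (map G bs) = prod_list (map G' bs)" if "bs \<in> compositions \<alpha> - {[\<alpha>]}" for bs
        using that 1 length_block_less by (intro arg_cong[of _ _ prod_list] map_cong) auto
      then have "(\<Sum>bs\<in>compositions \<alpha> - {[\<alpha>]}. F (map semigroup_sum bs) * prod_list (map G bs)) =
          (\<Sum>bs\<in>compositions \<alpha> - {[\<alpha>]}. F (map semigroup_sum bs) * prod_list (map G' bs))"
        by (intro sum.cong) simp_all
      then show ?thesis using split[of G] split[of G'] eq by simp
    qed (use G G' in \<open>simp add: collections_def\<close>)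
  qed
qed

lemma plethysm_identity_right:
  assumes "F \<in> collections"
  shows "plethysm F identity_collection = F"
proof
  fix \<alpha> :: "'a list"
  show "plethysm F identity_collection \<alpha> = F \<alpha>"
  proof (cases "\<alpha> = []")
    case False
    let ?o = "map (\<lambda>x. [x]) \<alpha>"
    have "prod_list (map identity_collection bs) = 0"
      if "bs \<in> compositions \<alpha> - {?o}" for bs
    proof -
      have "\<exists>b\<in>set bs. length b \<noteq> 1"
      proof (rule ccontr)
        assume "\<not> ?thesis"
        then have "bs = map (\<lambda>x. [x]) (concat bs)"
          by (induction bs) (auto simp: length_Suc_conv)
        then show False using that by (simp add: compositions_def)
      qed
      then show ?thesis by (force simp: prod_list_zero_iff identity_collection_def)
    qed
    moreover have "prod_list (map identity_collection (map (\<lambda>x. [x]) xs)) = 1" for xs :: "'a list"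
      by (induction xs) (auto simp: identity_collection_def)
    moreover have "map semigroup_sum ?o = \<alpha>" by (simp add: comp_def)
    ultimately show ?thesis using False
      by (simp add: plethysm_compositions finite_compositions
          sum.remove[OF _ singletons_mem_compositions])
  qed (use assms in \<open>simp add: plethysm_Nil collections_def\<close>)
qed

lemma plethysm_identity_left:
  assumes "G \<in> collections"
  shows "plethysm identity_collection G = G"
proof
  fix \<alpha>
  show "plethysm identity_collection G \<alpha> = G \<alpha>"
  proof (cases "\<alpha> = []")
    case False
    have "bs = [\<alpha>]" if "bs \<in> compositions \<alpha>" "length bs = 1" for bs
      using that by (auto simp: compositions_def length_Suc_conv)
    then have "identity_collection (map semigroup_sum bs) = 0" if "bs \<in> compositions \<alpha> - {[\<alpha>]}" for bs
      using that by (auto simp: identity_collection_def)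
    then show ?thesis using False
      by (simp add: plethysm_compositions finite_compositions identity_collection_def
          sum.remove[OF _ singleton_mem_compositions])
  qed (use assms in \<open>simp add: plethysm_Nil collections_def\<close>)
qed

text \<open>
  From \<open>G \<circ> F = 1\<close> follows \<open>G \<circ> (F \<circ> G) = G = G \<circ> 1\<close>, and cancelling \<open>G\<close> yields
  \<open>F \<circ> G = 1\<close>. Cancelling \<open>F\<close> shows that no other collection has this property.
\<close>

lemma plethysm_inverse_eqI:
  assumes F: "\<And>x. F [x] = 1"
    and G: "G \<in> collections" "\<And>x. G [x] = 1"
    and GF: "plethysm G F = identity_collection"
  shows "plethysm_inverse F = G"
proof -
  have "plethysm G (plethysm F G) = plethysm G identity_collection"
    by (simp add: plethysm_assoc[symmetric] GF plethysm_identity_left plethysm_identity_right G(1))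
  then have FG: "plethysm F G = identity_collection"
    by (intro plethysm_left_cancel[of G "plethysm F G" identity_collection])
      (simp_all add: collections_def plethysm_Nil identity_collection_def G(2))
  show ?thesis unfolding plethysm_inverse_def
  proof (rule the_equality)
    show "G \<in> collections \<and> plethysm F G = identity_collection \<and> plethysm G F = identity_collection"
      using G(1) FG GF by blast
    show "G' = G" if "G' \<in> collections \<and> plethysm F G' = identity_collection \<and>
        plethysm G' F = identity_collection" for G'
      using that F G(1) FG by (intro plethysm_left_cancel[of F G' G]) simp_all
  qed
qed

section \<open>Cut positions of a composition\<close>

definition cuts :: "'a list list \<Rightarrow> nat set" where
  "cuts bs = (\<lambda>k. length (concat (take k bs))) ` {1..<length bs}"

lemma cuts_singleton: "cuts [b] = {}"
  by (simp add: cuts_def)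

lemma cuts_Cons:
  assumes "bs \<noteq> []"
  shows "cuts (b # bs) = insert (length b) ((+) (length b) ` cuts bs)"
proof -
  have "{1..<length (b # bs)} = insert 1 (Suc ` {1..<length bs})"
    using assms by (cases bs) (auto simp: image_iff Bex_def gr0_conv_Suc)
  then have "cuts (b # bs) =
      (\<lambda>k. length (concat (take k (b # bs)))) ` insert 1 (Suc ` {1..<length bs})"
    by (simp only: cuts_def)
  then show ?thesis by (simp add: cuts_def image_image del: image_Suc_atLeastLessThan)
qed

lemma strict_mono_block_starts:
  assumes "[] \<notin> set bs" "k < l" "l \<le> length bs"
  shows "length (concat (take k bs)) < length (concat (take l bs))"
proof -
  have "take l bs = take k bs @ take (l - k) (drop k bs)"
    using assms(2) by (metis le_add_diff_inverse less_imp_le_nat take_add)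
  moreover have "concat (take (l - k) (drop k bs)) \<noteq> []"
    using assms by (subst concat_eq_Nil_if_no_empty_block) (auto dest!: in_set_takeD in_set_dropD)
  ultimately show ?thesis by simp
qed

lemma inj_on_block_starts:
  assumes "[] \<notin> set bs"
  shows "inj_on (\<lambda>k. length (concat (take k bs))) {1..<length bs}"
proof (rule linorder_inj_onI')
  fix k l assume "k \<in> {1..<length bs}" "l \<in> {1..<length bs}" "k < l"
  then show "length (concat (take k bs)) \<noteq> length (concat (take l bs))"
    using strict_mono_block_starts[OF assms, of k l] by simp
qed

lemma inj_on_insert_Pow: "a \<notin> A \<Longrightarrow> inj_on (insert a) (Pow A)"
  by (rule inj_onI) (metis Diff_insert_absorb PowD subsetD)

text \<open>
  By induction on the list: passing from a composition of \<open>xs\<close> to one of \<open>x # xs\<close> shifts the cuts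
  by one, and it adds a cut at position 1 precisely if \<open>x\<close> becomes a block of its own.
\<close>

lemma bij_betw_cuts:
  assumes "xs \<noteq> []"
  shows "bij_betw cuts (compositions xs) (Pow {1..<length xs})"
  using assms
proof (induction xs)
  case (Cons x xs)
  show ?case
  proof (cases "xs = []")
    case True
    then show ?thesis by (auto simp: compositions_singleton cuts_singleton bij_betw_def)
  next
    case False
    let ?C = "compositions xs" and ?X = "{1..<length xs}"
    have ne: "bs \<noteq> []" if "bs \<in> ?C" for bs using that False by (auto simp: compositions_def)
    have new: "cuts ([x] # bs) = insert 1 (Suc ` cuts bs)" if "bs \<in> ?C" for bs
      using ne[OF that] by (simp add: cuts_Cons)
    have glue: "cuts ((x # hd bs) # tl bs) = Suc ` cuts bs" if "bs \<in> ?C" for bs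
    proof (cases bs)
      case (Cons b cs)
      then show ?thesis
        by (cases "cs = []") (simp_all add: cuts_singleton cuts_Cons image_image)
    qed (use ne[OF that] in simp)
    have bij: "bij_betw (\<lambda>bs. Suc ` cuts bs) ?C (Pow (Suc ` ?X))"
    proof -
      have "bij_betw ((`) Suc) (Pow ?X) (Pow (Suc ` ?X))"
        by (simp add: bij_betw_def image_Pow_surj inj_on_image_Pow)
      from bij_betw_trans[OF Cons.IH[OF False] this] show ?thesis by (simp add: comp_def)
    qed
    have bij_insert: "bij_betw (\<lambda>bs. insert 1 (Suc ` cuts bs)) ?C (insert 1 ` Pow (Suc ` ?X))"
    proof -
      have "inj_on (insert 1) (Pow (Suc ` ?X))"
        by (rule inj_on_insert_Pow) auto
      then have "bij_betw (insert 1) (Pow (Suc ` ?X)) (insert 1 ` Pow (Suc ` ?X))"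
        by (simp add: bij_betw_def)
      from bij_betw_trans[OF bij this] show ?thesis by (simp add: comp_def)
    qed
    have image: "bij_betw cuts (g ` ?C) T" if "bij_betw (\<lambda>bs. cuts (g bs)) ?C T"
      for g :: "'a list list \<Rightarrow> 'a list list" and T
      using that inj_on_imageI[of cuts g ?C] by (simp add: bij_betw_def image_image comp_def)
    have "bij_betw cuts ((\<lambda>bs. [x] # bs) ` ?C) (insert 1 ` Pow (Suc ` ?X))"
      using new by (intro image bij_betw_cong[THEN iffD2, OF _ bij_insert])
    moreover have "bij_betw cuts ((\<lambda>bs. (x # hd bs) # tl bs) ` ?C) (Pow (Suc ` ?X))"
      using glue by (intro image bij_betw_cong[THEN iffD2, OF _ bij])
    moreover have "insert 1 ` Pow (Suc ` ?X) \<inter> Pow (Suc ` ?X) = {}" by auto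
    ultimately have "bij_betw cuts (compositions (x # xs)) (insert 1 ` Pow (Suc ` ?X) \<union> Pow (Suc ` ?X))"
      unfolding compositions_Cons[OF False] by (rule bij_betw_combine)
    also have "insert 1 ` Pow (Suc ` ?X) \<union> Pow (Suc ` ?X) = Pow (insert 1 (Suc ` ?X))"
      by (simp add: Pow_insert Un_commute)
    also have "insert 1 (Suc ` ?X) = {1..<length (x # xs)}"
      using False by (cases xs) (auto simp: image_iff Bex_def gr0_conv_Suc)
    finally show ?thesis .
  qed
qed simp

text \<open>
  A sum over compositions whose terms are products of local weights, \<open>p k\<close> for cutting at \<open>k\<close> and
  \<open>q k\<close> for not cutting there, factors over the positions.
\<close>

lemma sum_compositions_cuts:
  fixes p q :: "nat \<Rightarrow> 'b::comm_semiring_1"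
  assumes "xs \<noteq> []"
  shows "(\<Sum>bs\<in>compositions xs. (\<Prod>k\<in>cuts bs. p k) * (\<Prod>k\<in>{1..<length xs} - cuts bs. q k)) =
    (\<Prod>k\<in>{1..<length xs}. p k + q k)"
  unfolding prod_add[OF finite_atLeastLessThan]
  by (rule sum.reindex_bij_betw[OF bij_betw_cuts[OF assms]])

section \<open>The two Harder--Narasimhan factors in terms of cuts\<close>

text \<open>
  The claimed inverse, written as a product over positions so that \<open>sum_compositions_cuts\<close> applies
  to it; the sign \<open>(- 1) ^ (n - 1)\<close> is distributed over the factors.
\<close>

definition HN_inverse :: "('a::ab_semigroup_add \<Rightarrow> 'a \<Rightarrow> bool) \<Rightarrow> 'a list \<Rightarrow> rat" where
  "HN_inverse le \<alpha> = (if \<alpha> = [] then 0 else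
    (\<Prod>k\<in>{1..<length \<alpha>}. - of_bool (strictly_less le (semigroup_sum (drop k \<alpha>)) (semigroup_sum (take k \<alpha>)))))"

lemma HN_inverse_eq:
  assumes "\<alpha> \<noteq> []"
  shows "HN_inverse le \<alpha> =
    (if \<forall>k. 1 \<le> k \<and> k < length \<alpha> \<longrightarrow>
          strictly_less le (semigroup_sum (drop k \<alpha>)) (semigroup_sum (take k \<alpha>))
     then (- 1) ^ (length \<alpha> - 1) else 0)"
  using assms by (auto simp: HN_inverse_def)

text \<open>
  A proper prefix of the list of block sums has the same sum as the prefix of \<open>\<alpha>\<close> that ends at the
  corresponding cut, and likewise for suffixes. So only the cuts are tested.
\<close>

lemma HN_inverse_map_semigroup_sum:
  assumes "bs \<in> compositions \<alpha>" "\<alpha> \<noteq> []"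
  shows "HN_inverse le (map semigroup_sum bs) =
    (\<Prod>k\<in>cuts bs. - of_bool (strictly_less le (semigroup_sum (drop k \<alpha>)) (semigroup_sum (take k \<alpha>))))"
proof -
  have cat: "concat bs = \<alpha>" and ne: "[] \<notin> set bs" and "bs \<noteq> []"
    using assms by (auto simp: compositions_def)
  have "semigroup_sum (take k (map semigroup_sum bs)) = semigroup_sum (take (length (concat (take k bs))) \<alpha>)
    \<and> semigroup_sum (drop k (map semigroup_sum bs)) = semigroup_sum (drop (length (concat (take k bs))) \<alpha>)"
    if k: "k \<in> {1..<length bs}" for k
  proof -
    have "\<alpha> = concat (take k bs) @ concat (drop k bs)"
      by (metis cat append_take_drop_id concat_append)
    moreover have "[] \<notin> set (take k bs)" "[] \<notin> set (drop k bs)" "take k bs \<noteq> []" "drop k bs \<noteq> []"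
      using k ne \<open>bs \<noteq> []\<close> by (auto dest: in_set_takeD in_set_dropD)
    ultimately show ?thesis
      by (simp add: take_map drop_map semigroup_sum_concat)
  qed
  then show ?thesis using \<open>bs \<noteq> []\<close>
    by (simp add: HN_inverse_def cuts_def prod.reindex[OF inj_on_block_starts[OF ne]] del: One_nat_def)
qed

text \<open>
  Two neighbouring entries lie in a common block exactly if there is no cut between them.
\<close>

lemma successively_blocks_iff:
  assumes "[] \<notin> set bs"
  shows "(\<forall>b\<in>set bs. successively R b) \<longleftrightarrow>
    (\<forall>k\<in>{1..<length (concat bs)} - cuts bs. R (concat bs ! (k - 1)) (concat bs ! k))"
  using assms
proof (induction bs)
  case (Cons b bs)
  have succ: "successively R c \<longleftrightarrow> (\<forall>k\<in>{1..<length c}. R (c ! (k - 1)) (c ! k))" for c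
  proof -
    have "{1..<length c} = Suc ` {..<length c - 1}"
      by (cases c) (simp_all add: lessThan_atLeast0)
    then show ?thesis by (auto simp: successively_conv_nth )
  qed
  show ?case
  proof (cases "bs = []")
    case True
    then show ?thesis by (simp add: cuts_singleton succ)
  next
    case False
    let ?l = "length b" and ?n = "length (concat bs)" and ?\<alpha> = "concat (b # bs)"
    have "0 < ?l" using Cons.prems by auto
    have "0 < ?n" using False Cons.prems by (simp add: concat_eq_Nil_if_no_empty_block del: concat_eq_Nil_conv)
    have positions: "{1..<length ?\<alpha>} - cuts (b # bs) = {1..<?l} \<union> (+) ?l ` ({1..<?n} - cuts bs)"
    proof -
      have "{1..<l + n} = {1..<l} \<union> insert l ((+) l ` {1..<n})" if "0 < l" "0 < n" for l n :: nat
        using that by auto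
      from this[OF \<open>0 < ?l\<close> \<open>0 < ?n\<close>]
      have "{1..<length ?\<alpha>} = {1..<?l} \<union> insert ?l ((+) ?l ` {1..<?n})" by simp
      moreover have "(+) ?l ` ({1..<?n} - cuts bs) = (+) ?l ` {1..<?n} - (+) ?l ` cuts bs"
        by (simp add: image_set_diff)
      ultimately show ?thesis unfolding cuts_Cons[OF False] by auto
    qed
    have tail: "(\<forall>k\<in>(+) ?l ` ({1..<?n} - cuts bs). R (?\<alpha> ! (k - 1)) (?\<alpha> ! k)) \<longleftrightarrow>
        (\<forall>b\<in>set bs. successively R b)"
    proof -
      have shift: "?\<alpha> ! (?l + k - 1) = concat bs ! (k - 1)" "?\<alpha> ! (?l + k) = concat bs ! k"
        if "1 \<le> k" for k
        using that by (cases k; simp add: nth_append)+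
      have "(\<forall>k\<in>(+) ?l ` ({1..<?n} - cuts bs). R (?\<alpha> ! (k - 1)) (?\<alpha> ! k)) \<longleftrightarrow>
          (\<forall>k\<in>{1..<?n} - cuts bs. R (?\<alpha> ! (?l + k - 1)) (?\<alpha> ! (?l + k)))"
        by blast
      also have "\<dots> \<longleftrightarrow> (\<forall>k\<in>{1..<?n} - cuts bs. R (concat bs ! (k - 1)) (concat bs ! k))"
        by (intro ball_cong refl) (simp only: shift Diff_iff atLeastLessThan_iff)
      also have "\<dots> \<longleftrightarrow> (\<forall>b\<in>set bs. successively R b)"
        using Cons.prems by (intro Cons.IH[symmetric]) simp
      finally show ?thesis .
    qed
    have head: "(\<forall>k\<in>{1..<?l}. R (?\<alpha> ! (k - 1)) (?\<alpha> ! k)) \<longleftrightarrow> successively R b"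
      unfolding succ[of b] by (intro ball_cong refl) (auto simp: nth_append)
    show ?thesis unfolding positions ball_Un tail head by simp
  qed
qed simp

lemma prod_of_bool: "finite A \<Longrightarrow> (\<Prod>x\<in>A. of_bool (P x)) = (of_bool (\<forall>x\<in>A. P x) :: 'b::comm_semiring_1)"
  by (induction A rule: finite_induct) auto

lemma prod_list_HN_collection:
  assumes "bs \<in> compositions \<alpha>"
  shows "prod_list (map (HN_collection le) bs) =
    (\<Prod>k\<in>{1..<length \<alpha>} - cuts bs. of_bool (strictly_less le (\<alpha> ! k) (\<alpha> ! (k - 1))))"
proof -
  let ?R = "\<lambda>a b. strictly_less le b a"
  have ne: "[] \<notin> set bs" using assms by (simp add: compositions_def)
  then have "prod_list (map (HN_collection le) bs) = of_bool (\<forall>b\<in>set bs. successively ?R b)"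
    by (induction bs) (auto simp: HN_collection_def)
  then show ?thesis using assms successively_blocks_iff[OF ne, of ?R]
    by (simp add: prod_of_bool compositions_def)
qed

section \<open>The consequence of stability\<close>

lemma stability_refl: "stability le \<Longrightarrow> le a a"
  by (auto simp: stability_def)

text \<open>
  If the second alternative in the definition of a stability holds as well as \<open>a \<le> b\<close>, then
  \<open>a\<close>, \<open>b\<close> and \<open>a + b\<close> are all equivalent, so the first one holds too.
\<close>

lemma stability_between:
  assumes "stability le" "le a b"
  shows "le a (a + b)" "le (a + b) b"
proof -
  have trans: "le x z" if "le x y" "le y z" for x y z
    using assms(1) that by (auto simp: stability_def dest: transpD)
  have "(le a (a + b) \<and> le (a + b) b) \<or> (le b (a + b) \<and> le (a + b) a)"
    using assms(1) by (simp add: stability_def)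
  then show "le a (a + b)" "le (a + b) b" using trans assms(2) by metis+
qed

text \<open>
  Number the entries \<open>\<alpha>\<^sub>1, \<dots>, \<alpha>\<^sub>n\<close> and let \<open>T\<^sub>k\<close> and \<open>U\<^sub>k\<close> be the sums of the first \<open>k\<close> entries and of
  the others. Suppose that for every \<open>k\<close> exactly one of \<open>\<alpha>\<^sub>k > \<alpha>\<^sub>k\<^sub>+\<^sub>1\<close> and \<open>T\<^sub>k > U\<^sub>k\<close> holds. If
  \<open>T\<^sub>1 \<le> U\<^sub>1\<close>, then the sequence starts with a descent and \<open>\<alpha>\<^sub>2\<close> is smaller than \<open>T\<^sub>1\<close>, so moving it
  from \<open>U\<^sub>1\<close> to \<open>T\<^sub>1\<close> does not raise the prefix and does not lower the suffix. Hence
  \<open>T\<^sub>2 \<le> U\<^sub>2\<close>, and the situation propagates to \<open>k = n - 1\<close>. There \<open>\<alpha>\<^sub>n = U\<^sub>k\<close> is at least \<open>T\<^sub>k\<close>, but also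
  smaller than \<open>T\<^sub>k\<close> by the descent. If \<open>T\<^sub>1 > U\<^sub>1\<close>, the same argument applies with all
  inequalities reversed and strict and weak ones exchanged. For a stability given by slopes this
  says that a polygonal path with at least two steps cannot be strictly concave at exactly those
  inner vertices that lie on or below its chord.
\<close>

lemma exists_cut_agreeing:
  assumes stab: "stability le" and n: "2 \<le> length \<alpha>"
  shows "\<exists>k\<in>{1..<length \<alpha>}. strictly_less le (\<alpha> ! k) (\<alpha> ! (k - 1)) \<longleftrightarrow>
    strictly_less le (semigroup_sum (drop k \<alpha>)) (semigroup_sum (take k \<alpha>))"
proof (rule ccontr)
  let ?n = "length \<alpha>"
  define T where "T k = semigroup_sum (take k \<alpha>)" for k
  define U where "U k = semigroup_sum (drop k \<alpha>)" for k
  assume "\<not> ?thesis"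
  then have opp: "le (T k) (U k) \<longleftrightarrow> strictly_less le (\<alpha> ! k) (\<alpha> ! (k - 1))" if "k \<in> {1..<?n}" for k
    using that stab by (auto simp: T_def U_def strictly_less_def stability_def)
  have trans: "le a c" if "le a b" "le b c" for a b c
    using stab that by (auto simp: stability_def dest: transpD)
  have total: "le a b \<or> le b a" for a b using stab by (simp add: stability_def)
  note between = stability_between[OF stab]
  have T1: "T 1 = \<alpha> ! 0" using n by (cases \<alpha>) (auto simp: T_def)
  have T_Suc: "T (Suc k) = T k + \<alpha> ! k" if "k \<in> {1..<?n}" for k
    using that semigroup_sum_append[of "take k \<alpha>" "[\<alpha> ! k]"]
    using n by (cases "\<alpha> = []") (auto simp: T_def take_Suc_conv_app_nth)
  have U_Suc: "U k = \<alpha> ! k + U (Suc k)" if "Suc k < ?n" for k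
  proof -
    have "drop k \<alpha> = \<alpha> ! k # drop (Suc k) \<alpha>" using that by (simp add: Cons_nth_drop_Suc)
    then show ?thesis using that by (simp add: U_def semigroup_sum_Cons)
  qed
  have U_last: "U (?n - 1) = \<alpha> ! (?n - 1)"
  proof -
    have "drop (?n - 1) \<alpha> = \<alpha> ! (?n - 1) # drop (Suc (?n - 1)) \<alpha>"
      using n by (intro Cons_nth_drop_Suc[symmetric]) simp
    then show ?thesis using n by (simp add: U_def)
  qed
  have last: "?n - 1 \<in> {1..<?n}" using n by auto
  show False
  proof (cases "le (T 1) (U 1)")
    case True
    \<comment> \<open>The second conjunct holds because the entries descend so far.\<close>
    have "le (T k) (U k) \<and> le (\<alpha> ! (k - 1)) (T k)" if "1 \<le> k" "k < ?n" for k
      using that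
    proof (induction k rule: dec_induct)
      case base
      then show ?case using True T1 stability_refl[OF stab] by simp
    next
      case (step k)
      then have k: "k \<in> {1..<?n}" and IH: "le (T k) (U k)" "le (\<alpha> ! (k - 1)) (T k)" by auto
      have less: "strictly_less le (\<alpha> ! k) (T k)"
        using opp[OF k] IH trans unfolding strictly_less_def by metis
      have 1: "le (\<alpha> ! k) (T (Suc k))" "le (T (Suc k)) (T k)"
        using between[of "\<alpha> ! k" "T k"] less T_Suc[OF k]
        by (simp_all add: strictly_less_def add.commute)
      \<comment> \<open>Otherwise \<open>U k\<close> would be at most \<open>\<alpha> ! k\<close>, hence smaller than \<open>T k\<close>.\<close>
      have "\<not> le (U (Suc k)) (\<alpha> ! k)"
      proof
        assume "le (U (Suc k)) (\<alpha> ! k)"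
        then have "le (U k) (\<alpha> ! k)"
          using between[of "U (Suc k)" "\<alpha> ! k"] U_Suc[of k] step by (simp add: add.commute)
        then show False using less IH trans unfolding strictly_less_def by metis
      qed
      then have "le (U k) (U (Suc k))"
        using between(1)[of "\<alpha> ! k" "U (Suc k)"] between(2)[of "\<alpha> ! k" "U (Suc k)"]
          total[of "\<alpha> ! k" "U (Suc k)"] U_Suc[of k] step by auto
      then have "le (T (Suc k)) (U (Suc k))" using 1(2) IH(1) trans by metis
      then show ?case using 1(1) by simp
    qed
    from this[of "?n - 1"] last have "le (T (?n - 1)) (\<alpha> ! (?n - 1))" "le (\<alpha> ! (?n - 1 - 1)) (T (?n - 1))"
      using U_last by auto
    then show False using opp[OF last] U_last trans unfolding strictly_less_def by metis
  next
    case False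
    have "\<not> le (T k) (U k) \<and> le (T k) (\<alpha> ! (k - 1))" if "1 \<le> k" "k < ?n" for k
      using that
    proof (induction k rule: dec_induct)
      case base
      then show ?case using False T1 stability_refl[OF stab] by simp
    next
      case (step k)
      then have k: "k \<in> {1..<?n}" and IH: "\<not> le (T k) (U k)" "le (T k) (\<alpha> ! (k - 1))" by auto
      have leq: "le (T k) (\<alpha> ! k)"
        using opp[OF k] IH trans total unfolding strictly_less_def by metis
      have 1: "le (T k) (T (Suc k))" "le (T (Suc k)) (\<alpha> ! k)"
        using between[OF leq] T_Suc[OF k] by simp_all
      have "\<not> le (\<alpha> ! k) (U (Suc k))"
      proof
        assume "le (\<alpha> ! k) (U (Suc k))"
        then have "le (\<alpha> ! k) (U k)"
          using between[of "\<alpha> ! k" "U (Suc k)"] U_Suc[of k] step by simp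
        then show False using leq IH trans by metis
      qed
      then have "le (U (Suc k)) (U k)"
        using between(1)[of "U (Suc k)" "\<alpha> ! k"] total[of "\<alpha> ! k" "U (Suc k)"] U_Suc[of k] step
        by (auto simp: add.commute)
      then have "\<not> le (T (Suc k)) (U (Suc k))" using 1(1) IH(1) trans by metis
      then show ?case using 1(2) by simp
    qed
    from this[of "?n - 1"] last have "\<not> le (T (?n - 1)) (\<alpha> ! (?n - 1))" "le (T (?n - 1)) (\<alpha> ! (?n - 1 - 1))"
      using U_last by auto
    then show False using opp[OF last] U_last trans total unfolding strictly_less_def by metis
  qed
qed

lemma plethysm_HN_inverse_HN_collection:
  assumes stab: "stability le"
  shows "plethysm (HN_inverse le) (HN_collection le) = identity_collection"
proof
  fix \<alpha> :: "'a list"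
  show "plethysm (HN_inverse le) (HN_collection le) \<alpha> = identity_collection \<alpha>"
  proof (cases "\<alpha> = []")
    case False
    let ?P = "\<lambda>k. strictly_less le (semigroup_sum (drop k \<alpha>)) (semigroup_sum (take k \<alpha>))"
    let ?Q = "\<lambda>k. strictly_less le (\<alpha> ! k) (\<alpha> ! (k - 1))"
    have "plethysm (HN_inverse le) (HN_collection le) \<alpha> =
        (\<Prod>k\<in>{1..<length \<alpha>}. - of_bool (?P k) + of_bool (?Q k))"
      unfolding sum_compositions_cuts[OF False, symmetric] plethysm_compositions[OF False]
      by (intro sum.cong) (simp_all add: HN_inverse_map_semigroup_sum False prod_list_HN_collection)
    also have "\<dots> = identity_collection \<alpha>"
    proof (cases "length \<alpha> = 1")
      case False
      then have "2 \<le> length \<alpha>" using \<open>\<alpha> \<noteq> []\<close> by (cases \<alpha>; cases "tl \<alpha>") auto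
      then obtain k where "k \<in> {1..<length \<alpha>}" "?Q k \<longleftrightarrow> ?P k"
        using exists_cut_agreeing[OF stab] by blast
      then have "(\<Prod>k\<in>{1..<length \<alpha>}. - of_bool (?P k) + of_bool (?Q k) :: rat) = 0"
        by (intro prod_zero bexI[of _ k]) simp_all
      then show ?thesis using False by (simp add: identity_collection_def)
    qed (simp add: identity_collection_def)
    finally show ?thesis .
  qed (simp add: plethysm_Nil identity_collection_def)
qed

theorem theorem2p13:
  fixes le :: "'a::ab_semigroup_add \<Rightarrow> 'a \<Rightarrow> bool" and \<alpha> :: "'a list"
  assumes finite_decompositions: "\<And>x::'a. finite {\<beta>. \<beta> \<noteq> [] \<and> semigroup_sum \<beta> = x}"
    and stab: "stability le"
    and nonempty: "\<alpha> \<noteq> []"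
  shows "plethysm_inverse (HN_collection le) \<alpha> =
    (if \<forall>k. 1 \<le> k \<and> k < length \<alpha> \<longrightarrow>
          strictly_less le (semigroup_sum (drop k \<alpha>)) (semigroup_sum (take k \<alpha>))
     then (- 1) ^ (length \<alpha> - 1) else 0)"
proof -
  have "plethysm_inverse (HN_collection le) = HN_inverse le"
    by (rule plethysm_inverse_eqI[OF _ _ _ plethysm_HN_inverse_HN_collection[OF stab]])
      (simp_all add: HN_collection_def HN_inverse_def collections_def)
  then show ?thesis using HN_inverse_eq[OF nonempty] by simp
qed

end
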